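(* Let $m$ be a positive integer, and let $a$ be an integer that can be written as a sum of $3$ squares modulo $m$, i.e. there exist integers $z_1,z_2,z_3$ with $z_1^2+z_2^2+z_3^2\equiv a \pmod m$. Then there exists a constant $c_m>0$, depending only on $m$, such that there are infinitely many positive integers $n\equiv a \pmod m$ satisfying \[ r_3(n) \geq c_m \sqrt{n}\,\log\log n. \]
   Context: For a positive integer $n$, $r_3(n) := |\{(a,b,c)\in\mathbb{Z}^3 : a^2+b^2+c^2=n\}|$ denotes the number of representations of $n$ as a sum of three squares (counting signs and order). *)

theory Defs
  imports Complex_Main "HOL-Number_Theory.Cong"
begin

definition r3 :: "nat \<Rightarrow> nat" where
  "r3 n = card {(x :: int, y :: int, z :: int). x^2 + y^2 + z^2 = int n}"

end

theory Submission
  imports Defs "HOL-Computational_Algebra.Squarefree" "HOL-Analysis.Harmonic_Numbers"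
begin

text \<open>For an odd prime \<open>p\<close>, the congruence \<open>x\<^sup>2 + y\<^sup>2 + z\<^sup>2 \<equiv> -1\<close> has \<open>p\<^sup>2 + p\<close> solutions modulo \<open>p\<close>,
  \<open>1 + 1/p\<close> times the average over all residues. Let \<open>M = m P\<close>, where \<open>P\<close> is the
  product of the primes up to \<open>y\<close> not dividing \<open>2 m\<close>, and choose \<open>A \<equiv> a (mod m)\<close>, \<open>A \<equiv> -1 (mod P)\<close>.
  The box \<open>[0, M)\<^sup>3\<close> then contains at least \<open>P\<^sup>2 \<Prod>(1 + 1/p)\<close> points with
  \<open>x\<^sup>2 + y\<^sup>2 + z\<^sup>2 \<equiv> A (mod M)\<close>, while this sum of squares takes at most \<open>3 M\<close> values. Some value
  \<open>n < 3 M\<^sup>2\<close> is therefore attained at least \<open>M \<Prod>(1 + 1/p) / (3 m\<^sup>2)\<close> times; the product is of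
  order \<open>ln y\<close>, hence at least of order \<open>ln (ln n)\<close>.\<close>

section \<open>Logarithmic lower bound for the product of \<open>1 + 1/p\<close> over primes\<close>

lemma squarefree_eq_prod_prime_factors:
  fixes n :: nat
  assumes "squarefree n"
  shows "\<Prod>(prime_factors n) = n"
proof -
  have n0: "n \<noteq> 0" using assms by (auto intro: ccontr)
  have "(\<Prod>p\<in>prime_factors n. p ^ multiplicity p n) = n"
    using prod_prime_factors[OF n0] by simp
  moreover have "\<forall>p\<in>prime_factors n. multiplicity p n = 1"
    using assms squarefree_factorial_semiring'[OF n0] by blast
  ultimately show ?thesis by simp
qed

text \<open>The subtracted term strengthens the bound 2 so that the induction closes: each new
  summand is at most the telescoping difference \<open>1 / n - 1 / (n + 1)\<close>.\<close>

lemma sum_inverse_squares_le: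
  assumes "n > 0"
  shows "(\<Sum>d=1..n. 1 / real d ^ 2) \<le> 2 - 1 / real n"
  using assms
proof (induction n rule: nat_induct_non_zero)
  case 1
  then show ?case by simp
next
  case (Suc n)
  have "1 / real (Suc n) ^ 2 \<le> 1 / (real n * real (Suc n))"
    using Suc.hyps by (intro divide_left_mono) (auto simp: power2_eq_square)
  also have "\<dots> = 1 / real n - 1 / real (Suc n)"
    using Suc.hyps by (simp add: field_simps)
  finally show ?case using Suc.IH by simp
qed

text \<open>Writing \<open>k = s * d\<^sup>2\<close> with \<open>s\<close> squarefree bounds the harmonic sum by the product times \<open>\<Sum>1/d\<^sup>2 \<le> 2\<close>.\<close>

lemma ln_le_prod_primes:
  "ln (real n + 1) \<le> 2 * (\<Prod>p | prime p \<and> p \<le> n. 1 + 1 / real p)"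
proof (cases "n = 0")
  case True
  then show ?thesis by (auto intro!: prod_nonneg)
next
  case False
  define P where "P = {p. prime p \<and> p \<le> n}"
  have [simp]: "finite P" unfolding P_def by auto
  \<comment> \<open>\<open>\<phi>\<close> encodes \<open>k\<close> by the prime set of its
    squarefree part and by its square part; \<open>g\<close> is the weight that recovers
    \<open>1 / k\<close> from this code.\<close>
  define \<phi> where "\<phi> k = (prime_factors (squarefree_part k), square_part k)" for k :: nat
  define g where "g = (\<lambda>(X, d :: nat). (\<Prod>p\<in>X. 1 / real p) * (1 / real d ^ 2))"
  have dec: "\<Prod>(prime_factors (squarefree_part k)) * square_part k ^ 2 = k" for k :: nat
    using squarefree_eq_prod_prime_factors[of "squarefree_part k"] squarefree_decompose[of k] by auto
  have inj: "inj_on \<phi> {1..n}"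
    unfolding \<phi>_def by (rule inj_onI) (metis dec prod.inject)
  have sub: "\<phi> ` {1..n} \<subseteq> Pow P \<times> {1..n}"
  proof (rule image_subsetI)
    fix k assume k: "k \<in> {1..n}"
    have "squarefree_part k dvd k" "square_part k ^ 2 dvd k"
      using squarefree_decompose[of k] by (metis dvd_triv_left, auto)
    moreover have "square_part k dvd square_part k ^ 2" by (simp add: power2_eq_square)
    ultimately have *: "squarefree_part k dvd k" "square_part k dvd k"
      using dvd_trans by blast+
    have le: "d \<le> n" if "d dvd k" for d
      using dvd_imp_le[OF that] k by simp
    have "p \<le> n" if "p \<in> prime_factors (squarefree_part k)" for p
      using that *(1) by (intro le dvd_trans[OF _ *(1)]) (simp add: in_prime_factors_iff)
    then show "\<phi> k \<in> Pow P \<times> {1..n}"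
      using k le[OF *(2)] unfolding \<phi>_def P_def
      by (auto simp: in_prime_factors_iff Suc_le_eq intro!: Nat.gr0I)
  qed
  have "g (\<phi> k) = 1 / real k" for k
  proof -
    have "1 / real k = 1 / real (\<Prod>(prime_factors (squarefree_part k)) * square_part k ^ 2)"
      by (simp only: dec)
    also have "\<dots> = g (\<phi> k)"
      by (simp add: g_def \<phi>_def prod_dividef)
    finally show ?thesis by simp
  qed
  then have "(harm n :: real) = (\<Sum>k=1..n. g (\<phi> k))"
    by (simp add: harm_def inverse_eq_divide)
  also have "\<dots> = (\<Sum>x\<in>\<phi> ` {1..n}. g x)"
    using inj by (simp add: sum.reindex)
  \<comment> \<open>Enlarging the image to all pairs only adds nonnegative terms and makes the sum
    factor; its sum over subsets of \<open>P\<close> is the expanded product.\<close>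
  also have "\<dots> \<le> (\<Sum>x\<in>Pow P \<times> {1..n}. g x)"
    using sub by (intro sum_mono2) (auto simp: g_def intro!: mult_nonneg_nonneg prod_nonneg divide_nonneg_nonneg)
  also have "\<dots> = (\<Sum>X\<in>Pow P. \<Prod>p\<in>X. 1 / real p) * (\<Sum>d=1..n. 1 / real d ^ 2)"
    by (simp add: g_def sum_product sum.cartesian_product)
  also have "(\<Sum>X\<in>Pow P. \<Prod>p\<in>X. 1 / real p) = (\<Prod>p\<in>P. 1 + 1 / real p)"
    using prod_add[of P "\<lambda>p. 1 / real p" "\<lambda>_. 1"] by (simp add: add.commute)
  also have "\<dots> * (\<Sum>d=1..n. 1 / real d ^ 2) \<le> (\<Prod>p\<in>P. 1 + 1 / real p) * 2"
    using sum_inverse_squares_le[of n] False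
    by (intro mult_left_mono prod_nonneg) (auto intro: order_trans)
  finally show ?thesis using ln_le_harm[of n] unfolding P_def by linarith
qed

section \<open>Solution counts in a box and Chinese remaindering\<close>

definition sols3 :: "int \<Rightarrow> int \<Rightarrow> (int \<times> int \<times> int) set" where
  "sols3 A M = {(x, y, z). {x, y, z} \<subseteq> {0..<M} \<and> [x^2 + y^2 + z^2 = A] (mod M)}"

lemma finite_sols3 [simp]: "finite (sols3 A M)"
proof -
  have "sols3 A M \<subseteq> {0..<M} \<times> {0..<M} \<times> {0..<M}" by (auto simp: sols3_def)
  then show ?thesis by (rule finite_subset) auto
qed

lemma sols3_cong:
  assumes "[A = B] (mod M)"
  shows "sols3 A M = sols3 B M"
  using assms unfolding sols3_def by (blast intro: cong_trans cong_sym)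

lemma mod_in_sols3:
  assumes "M > 0" "[x^2 + y^2 + z^2 = A] (mod M)"
  shows "(x mod M, y mod M, z mod M) \<in> sols3 A M"
proof -
  have "[(x mod M)^2 + (y mod M)^2 + (z mod M)^2 = x^2 + y^2 + z^2] (mod M)"
    by (intro cong_add cong_pow) auto
  then show ?thesis using assms by (auto simp: sols3_def intro: cong_trans)
qed

text \<open>Chinese remaindering in each coordinate lifts a pair of solutions to a solution modulo
  \<open>M * N\<close>, so reduction to the two moduli covers all pairs.\<close>

lemma card_sols3_mult:
  assumes "coprime M N" "M > 0" "N > 0"
  shows "card (sols3 A M) * card (sols3 A N) \<le> card (sols3 A (M * N))"
proof -
  define f where "f = (\<lambda>(x, y, z). ((x mod M, y mod M, z mod M), (x mod N, y mod N, z mod N :: int)))"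
  have "sols3 A M \<times> sols3 A N \<subseteq> f ` sols3 A (M * N)"
  proof clarify
    fix x y z x' y' z'
    assume s: "(x, y, z) \<in> sols3 A M" and s': "(x', y', z') \<in> sols3 A N"
    obtain X where X: "[X = x] (mod M)" "[X = x'] (mod N)"
      using binary_chinese_remainder_int[OF assms(1)] by blast
    obtain Y where Y: "[Y = y] (mod M)" "[Y = y'] (mod N)"
      using binary_chinese_remainder_int[OF assms(1)] by blast
    obtain Z where Z: "[Z = z] (mod M)" "[Z = z'] (mod N)"
      using binary_chinese_remainder_int[OF assms(1)] by blast
    have "[X^2 + Y^2 + Z^2 = x^2 + y^2 + z^2] (mod M)" "[X^2 + Y^2 + Z^2 = x'^2 + y'^2 + z'^2] (mod N)"
      using X Y Z by (auto intro!: cong_add cong_pow)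
    with s s' have "[X^2 + Y^2 + Z^2 = A] (mod M)" "[X^2 + Y^2 + Z^2 = A] (mod N)"
      by (auto simp: sols3_def intro: cong_trans)
    then have "[X^2 + Y^2 + Z^2 = A] (mod M * N)"
      using assms(1) by (simp add: coprime_cong_mult)
    then have "(X mod (M * N), Y mod (M * N), Z mod (M * N)) \<in> sols3 A (M * N)"
      using assms by (intro mod_in_sols3) auto
    moreover have "f (X mod (M * N), Y mod (M * N), Z mod (M * N)) = ((x, y, z), (x', y', z'))"
      using s s' X Y Z by (auto simp: f_def sols3_def mod_mod_cancel cong_def)
    ultimately show "((x, y, z), (x', y', z')) \<in> f ` sols3 A (M * N)" by force
  qed
  then have "card (sols3 A M \<times> sols3 A N) \<le> card (f ` sols3 A (M * N))"
    by (intro card_mono) auto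
  also have "\<dots> \<le> card (sols3 A (M * N))" by (rule card_image_le) simp
  finally show ?thesis by (simp add: card_cartesian_product)
qed

section \<open>Solutions modulo an odd prime\<close>

text \<open>Pigeonhole: the residues \<open>x^2\<close> and \<open>- 1 - y^2\<close>, with
  \<open>x\<close> and \<open>y\<close> running over \<open>0..p div 2\<close>, form two sets of
  size \<open>(p + 1) / 2\<close>, too large to be disjoint modulo \<open>p\<close>.\<close>

lemma exists_sum_two_squares_cong_minus_one:
  fixes p :: int
  assumes "prime p" "odd p"
  obtains \<alpha> \<beta> where "[\<alpha>^2 + \<beta>^2 = -1] (mod p)"
proof -
  have p1: "p > 1" using assms(1) prime_gt_1_int by blast
  define R where "R = {0..p div 2}"
  have cardR: "card R = nat (p div 2 + 1)" using p1 by (simp add: R_def)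
  have inj: "inj_on (\<lambda>x. x^2 mod p) R"
  proof (rule inj_onI)
    fix x y assume xy: "x \<in> R" "y \<in> R" "x^2 mod p = y^2 mod p"
    then have "p dvd x^2 - y^2" by (simp add: mod_eq_dvd_iff)
    then have "p dvd (x - y) * (x + y)" by (simp add: algebra_simps power2_eq_square)
    then consider "p dvd x - y" | "p dvd x + y"
      using assms(1) prime_dvd_mult_iff by blast
    then show "x = y"
    proof cases
      case 1
      have "\<bar>x - y\<bar> < p" using xy p1 by (auto simp: R_def)
      with 1 show ?thesis using dvd_imp_le_int[of "x - y" p] p1 by force
    next
      case 2
      \<comment> \<open>As \<open>p\<close> is odd, twice \<open>p div 2\<close> is
        \<open>p - 1\<close>, so the sum stays below \<open>p\<close>.\<close>
      have "x + y \<ge> 0" "x + y < p" using xy assms(2) by (auto simp: R_def elim!: oddE)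
      with 2 have "x + y = 0" using zdvd_not_zless[of "x + y" p] by force
      then show ?thesis using xy by (auto simp: R_def)
    qed
  qed
  have inj': "inj_on (\<lambda>x. (- 1 - x^2) mod p) R"
  proof (rule inj_onI)
    fix x y assume xy: "x \<in> R" "y \<in> R" "(- 1 - x^2) mod p = (- 1 - y^2) mod p"
    then have "p dvd (- 1 - x^2) - (- 1 - y^2)" by (simp add: mod_eq_dvd_iff)
    then have "p dvd - (x^2 - y^2)" by simp
    then have "p dvd x^2 - y^2" by (simp only: dvd_minus_iff)
    then have "x^2 mod p = y^2 mod p" by (simp add: mod_eq_dvd_iff)
    then show "x = y" using inj xy by (auto dest: inj_onD)
  qed
  let ?A = "(\<lambda>x. x^2 mod p) ` R" and ?B = "(\<lambda>x. (- 1 - x^2) mod p) ` R"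
  have "?A \<inter> ?B \<noteq> {}"
  proof
    assume "?A \<inter> ?B = {}"
    then have "card (?A \<union> ?B) = card R + card R"
      using inj inj' by (subst card_Un_disjoint) (auto simp: card_image R_def)
    also have "\<dots> > nat p" using cardR p1 assms(2) by (auto elim!: oddE simp: nat_add_distrib)
    finally have "nat p < card (?A \<union> ?B)" .
    moreover have "card (?A \<union> ?B) \<le> card {0..<p}"
      using p1 by (intro card_mono) auto
    ultimately show False by simp
  qed
  then obtain x y where "x^2 mod p = (- 1 - y^2) mod p" by auto
  then have "[x^2 + y^2 = (- 1 - y^2) + y^2] (mod p)"
    unfolding cong_def[symmetric] by (intro cong_add) auto
  then show ?thesis by (intro that[of x y]) simp
qed

text \<open>If \<open>u\<close> is nonzero, \<open>4 * u\<close> is invertible and each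
  \<open>w\<close> admits a \<open>v\<close>: \<open>p * (p - 1)\<close> triples. If
  \<open>u = 0\<close>, then \<open>w\<close> may be 1 or -1 with \<open>v\<close> free:
  \<open>2 * p\<close> more.\<close>

lemma card_hyperboloid_mod_prime:
  fixes p :: int
  assumes "prime p" "odd p"
  shows "nat p ^ 2 + nat p \<le>
    card {(w, u, v). {w, u, v} \<subseteq> {0..<p} \<and> [4 * u * v = w^2 - 1] (mod p)}" (is "_ \<le> card ?W")
proof -
  have p2: "p > 2" using assms prime_ge_2_int[of p] by (cases "p = 2") auto
  have "\<exists>v. 0 \<le> v \<and> v < p \<and> [4 * u * v = w^2 - 1] (mod p)" if u: "u \<in> {1..<p}" for u w :: int
  proof -
    have "coprime u p" using u assms(1) zdvd_not_zless[of u p]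
      by (auto intro!: prime_imp_coprime simp: coprime_commute)
    moreover have "coprime (4 :: int) p" using coprime_power_left_iff[of 2 2 p] assms(2) by simp
    ultimately have "coprime (4 * u) p" by simp
    then obtain i where i: "[4 * u * i = 1] (mod p)" using cong_solve_coprime_int by blast
    have "[4 * u * ((i * (w^2 - 1)) mod p) = 4 * u * (i * (w^2 - 1))] (mod p)"
      by (intro cong_mult) auto
    also have "4 * u * (i * (w^2 - 1)) = (4 * u * i) * (w^2 - 1)" by simp
    also have "[(4 * u * i) * (w^2 - 1) = 1 * (w^2 - 1)] (mod p)"
      using i by (intro cong_mult) auto
    finally show ?thesis using p2 by (intro exI[of _ "(i * (w^2 - 1)) mod p"]) auto
  qed
  then obtain V where V: "\<And>u w. u \<in> {1..<p} \<Longrightarrow> V u w \<in> {0..<p} \<and> [4 * u * V u w = w^2 - 1] (mod p)"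
    by (metis atLeastLessThan_iff)
  let ?W1 = "(\<lambda>(w, u). (w, u, V u w)) ` ({0..<p} \<times> {1..<p})"
  let ?W2 = "(\<lambda>(w, v). (w, 0 :: int, v)) ` ({1, p - 1} \<times> {0..<p})"
  have c1: "card ?W1 = nat p * nat (p - 1)"
    by (subst card_image) (auto simp: inj_on_def card_cartesian_product)
  \<comment> \<open>\<open>p > 2\<close> keeps the two square roots 1 and \<open>p - 1\<close> of 1
    distinct.\<close>
  have c2: "card ?W2 = 2 * nat p"
    using p2 by (subst card_image) (auto simp: inj_on_def card_cartesian_product)
  have "p dvd (p - 1)^2 - 1" by (simp add: power2_eq_square algebra_simps)
  then have "[0 = (p - 1)^2 - 1] (mod p)" by (metis cong_0_iff cong_sym)
  then have sub: "?W1 \<union> ?W2 \<subseteq> ?W" using V p2 by auto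
  have "finite ?W"
    by (rule finite_subset[of _ "{0..<p} \<times> {0..<p} \<times> {0..<p}"]) auto
  then have "card (?W1 \<union> ?W2) \<le> card ?W" using sub by (rule card_mono)
  also have "card (?W1 \<union> ?W2) = card ?W1 + card ?W2"
    by (intro card_Un_disjoint) auto
  also have "\<dots> = nat p ^ 2 + nat p"
  proof -
    define q where "q = nat (p - 1)"
    have "nat p = Suc q" using p2 by (simp add: q_def)
    then show ?thesis unfolding c1 c2 q_def[symmetric] by (simp add: power2_eq_square)
  qed
  finally show ?thesis .
qed

text \<open>With \<open>\<alpha>\<^sup>2 + \<beta>\<^sup>2 = -1\<close>, the substitution \<open>x = \<alpha> w - \<beta> t\<close>, \<open>y = \<beta> w + \<alpha> t\<close> turns
  \<open>x\<^sup>2 + y\<^sup>2 + z\<^sup>2\<close> into \<open>(z - t) (z + t) - w\<^sup>2\<close>, and \<open>z = u + v\<close>, \<open>t = v - u\<close> into \<open>4 u v - w\<^sup>2\<close>.\<close>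

lemma card_sols3_prime:
  assumes "prime p" "odd p" "[A = -1] (mod p)"
  shows "nat p ^ 2 + nat p \<le> card (sols3 A p)"
proof -
  have p1: "p > 1" using assms(1) prime_gt_1_int by blast
  obtain \<alpha> \<beta> where ab: "[\<alpha>^2 + \<beta>^2 = -1] (mod p)"
    using exists_sum_two_squares_cong_minus_one assms by blast
  let ?W = "{(w, u, v). {w, u, v} \<subseteq> {0..<p} \<and> [4 * u * v = w^2 - 1] (mod p)}"
  define X Y where "X = (\<lambda>w u v. \<alpha> * w - \<beta> * (v - u))" and "Y = (\<lambda>w u v. \<beta> * w + \<alpha> * (v - u))"
  define f where "f = (\<lambda>(w, u, v). (X w u v mod p, Y w u v mod p, (u + v) mod p))"
  \<comment> \<open>These combinations invert the substitution up to the factor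
    \<open>\<alpha>^2 + \<beta>^2\<close>, which is -1 modulo \<open>p\<close> and hence cancels;
    this gives injectivity of \<open>f\<close>.\<close>
  have combw: "\<alpha> * X w u v + \<beta> * Y w u v = (\<alpha>^2 + \<beta>^2) * w"
    and combt: "\<alpha> * Y w u v - \<beta> * X w u v = (\<alpha>^2 + \<beta>^2) * (v - u)" for w u v
    unfolding X_def Y_def by algebra+
  have "f ` ?W \<subseteq> sols3 A p"
  proof (rule image_subsetI)
    fix s assume "s \<in> ?W"
    then obtain w u v where s: "s = (w, u, v)" and uvw: "[4 * u * v = w^2 - 1] (mod p)" by auto
    have "X w u v ^ 2 + Y w u v ^ 2 + (u + v) ^ 2 = (\<alpha>^2 + \<beta>^2) * (w^2 + (v - u)^2) + (u + v)^2"
      unfolding X_def Y_def by algebra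
    also have "[\<dots> = (-1) * (w^2 + (v - u)^2) + (u + v)^2] (mod p)"
      using ab by (intro cong_add cong_mult) auto
    also have "(-1) * (w^2 + (v - u)^2) + (u + v)^2 = 4 * u * v - w^2" by algebra
    also have "[\<dots> = (w^2 - 1) - w^2] (mod p)"
      using uvw by (intro cong_diff) auto
    also have "(w^2 - 1) - w^2 = -1" by simp
    also have "[-1 = A] (mod p)" using assms(3) by (rule cong_sym)
    finally show "f s \<in> sols3 A p"
      using p1 unfolding f_def s by (auto intro!: mod_in_sols3)
  qed
  moreover have "inj_on f ?W"
  proof (rule inj_onI)
    fix s s' assume "s \<in> ?W" "s' \<in> ?W" and eq: "f s = f s'"
    then obtain w u v w' u' v' where s: "s = (w, u, v)" "s' = (w', u', v')"
      and range: "{w, u, v} \<subseteq> {0..<p}" "{w', u', v'} \<subseteq> {0..<p}" by auto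
    have 1: "[X w u v = X w' u' v'] (mod p)" and 2: "[Y w u v = Y w' u' v'] (mod p)"
      and 3: "[u + v = u' + v'] (mod p)"
      using eq by (auto simp: s f_def cong_def)
    have neg: "[s = s'] (mod p)"
      if "[(\<alpha>^2 + \<beta>^2) * s = (\<alpha>^2 + \<beta>^2) * s'] (mod p)" for s s'
    proof -
      have "[(-1) * s = (\<alpha>^2 + \<beta>^2) * s] (mod p)" using ab by (intro cong_mult) (auto simp: cong_sym)
      also note that
      also have "[(\<alpha>^2 + \<beta>^2) * s' = (-1) * s'] (mod p)" using ab by (intro cong_mult) auto
      finally show ?thesis by (simp add: cong_minus_minus_iff)
    qed
    have "[\<alpha> * X w u v + \<beta> * Y w u v = \<alpha> * X w' u' v' + \<beta> * Y w' u' v'] (mod p)"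
      using 1 2 by (intro cong_add cong_mult) auto
    then have w: "[w = w'] (mod p)" unfolding combw by (rule neg)
    have "[\<alpha> * Y w u v - \<beta> * X w u v = \<alpha> * Y w' u' v' - \<beta> * X w' u' v'] (mod p)"
      using 1 2 by (intro cong_diff cong_mult) auto
    then have t: "[v - u = v' - u'] (mod p)" unfolding combt by (rule neg)
    \<comment> \<open>Since 2 is invertible modulo the odd \<open>p\<close>, \<open>u\<close> and
      \<open>v\<close> are determined by \<open>u + v\<close> and \<open>v - u\<close>.\<close>
    have half: "[s = s'] (mod p)" if "[2 * s = 2 * s'] (mod p)" for s s'
      using that assms(2) by (subst (asm) cong_mult_lcancel) (auto simp: coprime_commute)
    have "[2 * v = 2 * v'] (mod p)" using cong_add[OF 3 t] by simp
    moreover have "[2 * u = 2 * u'] (mod p)" using cong_diff[OF 3 t] by simp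
    ultimately have "[v = v'] (mod p)" "[u = u'] (mod p)" by (auto intro: half)
    with w range show "s = s'"
      by (auto simp: s intro: cong_less_imp_eq_int)
  qed
  ultimately have "card ?W \<le> card (sols3 A p)"
    by (metis (no_types, lifting) card_image card_mono finite_sols3)
  then show ?thesis using card_hyperboloid_mod_prime[OF assms(1,2)] by linarith
qed

section \<open>Composite moduli and the passage from residues to integers\<close>

text \<open>Primes are adjoined one at a time by multiplicativity, starting from the single solution
  modulo \<open>m\<close> that is assumed to exist.\<close>

lemma prod_le_card_sols3:
  fixes S :: "nat set"
  assumes "finite S" "\<And>p. p \<in> S \<Longrightarrow> prime p \<and> \<not> p dvd 2 * m \<and> [A = -1] (mod int p)"
    and "m > 0" "sols3 A (int m) \<noteq> {}"
  shows "(\<Prod>p\<in>S. p ^ 2 + p) \<le> card (sols3 A (int m * (\<Prod>p\<in>S. int p)))"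
  using assms(1,2)
proof (induction S rule: finite_induct)
  case empty
  then show ?case using assms(4) by (simp add: Suc_le_eq card_gt_0_iff)
next
  case (insert q S)
  let ?N = "int m * (\<Prod>p\<in>S. int p)"
  have q: "prime q" "\<not> q dvd 2 * m" "[A = -1] (mod int q)" using insert.prems by auto
  have odd: "odd q" using primes_dvd_imp_eq[of 2 q] q(1,2) by auto
  have qm: "\<not> q dvd m" using q(2) by auto
  have S0: "p > 0" if "p \<in> S" for p using insert.prems that prime_gt_0_nat by blast
  have "coprime q m" using q(1) qm by (simp add: prime_imp_coprime)
  moreover have "coprime q p" if "p \<in> S" for p
    using that q(1) insert by (intro primes_coprime) auto
  ultimately have "coprime (int q) ?N"
    by (auto intro!: prod_coprime_right)
  then have "card (sols3 A (int q)) * card (sols3 A ?N) \<le> card (sols3 A (int q * ?N))"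
    using S0 q(1) assms(3) prime_gt_0_nat by (intro card_sols3_mult) (auto intro!: prod_pos mult_pos_pos)
  moreover have "q ^ 2 + q \<le> card (sols3 A (int q))"
    using card_sols3_prime[of "int q" A] q odd by simp
  moreover have "(\<Prod>p\<in>S. p ^ 2 + p) \<le> card (sols3 A ?N)"
    using insert by auto
  ultimately have "(q ^ 2 + q) * (\<Prod>p\<in>S. p ^ 2 + p) \<le> card (sols3 A (int q * ?N))"
    using mult_le_mono order_trans by blast
  then show ?case using insert.hyps by (simp add: mult.left_commute)
qed

text \<open>Pigeonhole: on the box the sum of squares lies below \<open>3 * M^2\<close> and in one
  residue class modulo \<open>M\<close>, so it takes at most \<open>3 * M\<close> values, and each
  fibre has at most \<open>r3\<close> of its value elements.\<close>

lemma exists_r3_ge_card_sols3: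
  fixes M :: nat
  assumes "M > 0" "sols3 A (int M) \<noteq> {}"
  obtains n where "[int n = A] (mod int M)" "n \<le> 3 * M ^ 2"
    "card (sols3 A (int M)) \<le> 3 * M * r3 n"
proof -
  let ?S = "sols3 A (int M)"
  define g where "g = (\<lambda>(x :: int, y :: int, z :: int). nat (x^2 + y^2 + z^2))"
  have g: "[int n = A] (mod int M)" "n < 3 * M ^ 2" if n: "n \<in> g ` ?S" for n
  proof -
    obtain x y z where s: "(x, y, z) \<in> ?S" and n_eq: "n = g (x, y, z)" using n by force
    have *: "int n = x^2 + y^2 + z^2" by (simp add: n_eq g_def)
    show "[int n = A] (mod int M)" using s by (auto simp: * sols3_def)
    have "x^2 < int M ^ 2" "y^2 < int M ^ 2" "z^2 < int M ^ 2"
      using s by (auto simp: sols3_def intro!: power_strict_mono)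
    then have "int n < int (3 * M ^ 2)" unfolding * by simp
    then show "n < 3 * M ^ 2" by linarith
  qed
  \<comment> \<open>All values share a remainder modulo \<open>M\<close>, so the quotient determines
    the value.\<close>
  have "inj_on (\<lambda>n. n div M) (g ` ?S)"
  proof (rule inj_onI)
    fix n n' assume n: "n \<in> g ` ?S" "n' \<in> g ` ?S" "n div M = n' div M"
    have "[int n = int n'] (mod int M)" using g(1) n by (blast intro: cong_trans cong_sym)
    then have "n mod M = n' mod M" unfolding cong_int_iff by (simp add: cong_def)
    with n show "n = n'" by (metis div_mult_mod_eq)
  qed
  moreover have "(\<lambda>n. n div M) ` (g ` ?S) \<subseteq> {..<3 * M}"
    using g(2) by (auto simp: power2_eq_square less_mult_imp_div_less mult.assoc)
  ultimately have cardN: "card (g ` ?S) \<le> 3 * M"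
    using card_inj_on_le[of "\<lambda>n. n div M" "g ` ?S" "{..<3 * M}"] by simp
  have fib: "card {s \<in> ?S. g s = n} \<le> r3 n" for n
  proof -
    \<comment> \<open>An infinite set would have \<open>card\<close> equal to 0, so comparing the
      fibre with \<open>r3 n\<close> requires the lattice points on the sphere to be finite in
      number.\<close>
    have "{(x :: int, y :: int, z :: int). x^2 + y^2 + z^2 = int n} \<subseteq> {- int n..int n} \<times> {- int n..int n} \<times> {- int n..int n}"
    proof (rule subsetI)
      fix s assume "s \<in> {(x :: int, y :: int, z :: int). x^2 + y^2 + z^2 = int n}"
      then obtain x y z where s: "s = (x, y, z)" and eq: "x^2 + y^2 + z^2 = int n" by auto
      have "\<bar>t\<bar> \<le> t ^ 2" for t :: int
        using self_le_power[of "\<bar>t\<bar>" 2] by (cases "t = 0") auto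
      from this[of x] this[of y] this[of z] eq
      show "s \<in> {- int n..int n} \<times> {- int n..int n} \<times> {- int n..int n}"
        using zero_le_power2[of x] zero_le_power2[of y] zero_le_power2[of z] unfolding s by auto
    qed
    then have "finite {(x :: int, y :: int, z :: int). x^2 + y^2 + z^2 = int n}"
      by (rule finite_subset) auto
    then show ?thesis unfolding r3_def by (rule card_mono) (auto simp: g_def)
  qed
  \<comment> \<open>The witness is an attained value with the largest \<open>r3\<close>, which
    bounds every fibre at once.\<close>
  have "finite (r3 ` g ` ?S)" "r3 ` g ` ?S \<noteq> {}" using assms by auto
  then have "Max (r3 ` g ` ?S) \<in> r3 ` g ` ?S" by (rule Max_in)
  then obtain n where n: "n \<in> g ` ?S" "r3 n = Max (r3 ` g ` ?S)"
    by (metis (no_types, lifting) imageE)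
  have "card ?S = (\<Sum>k\<in>g ` ?S. card {s \<in> ?S. g s = k})"
    using sum.group[of ?S "g ` ?S" g "\<lambda>_. 1 :: nat"] by simp
  also have "\<dots> \<le> (\<Sum>k\<in>g ` ?S. r3 n)"
    using fib by (intro sum_mono order_trans[OF fib]) (auto simp: n(2))
  also have "\<dots> \<le> 3 * M * r3 n" using cardN by simp
  finally show ?thesis using that[of n] g[OF n(1)] by simp
qed

section \<open>Choice of the modulus and growth estimates\<close>

text \<open>At most \<open>k\<close> primes divide \<open>k\<close>, and each contributes a factor
  of at most 2. Omitting the primes that divide \<open>2 * m\<close> thus costs a constant depending
  only on \<open>m\<close>.\<close>

lemma prod_primes_le_prod_primes_not_dvd:
  assumes "k > 0"
  shows "(\<Prod>p | prime p \<and> p \<le> n. 1 + 1 / real p)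
    \<le> 2 ^ k * (\<Prod>p | prime p \<and> p \<le> n \<and> \<not> p dvd k. 1 + 1 / real p)"
proof -
  let ?S = "{p. prime p \<and> p \<le> n \<and> \<not> p dvd k}" and ?T = "{p. prime p \<and> p \<le> n \<and> p dvd k}"
  have [simp]: "finite ?S" "finite ?T" by auto
  have "{p. prime p \<and> p \<le> n} = ?T \<union> ?S" by auto
  then have "(\<Prod>p | prime p \<and> p \<le> n. 1 + 1 / real p)
      = (\<Prod>p\<in>?T. 1 + 1 / real p) * (\<Prod>p\<in>?S. 1 + 1 / real p)"
    by (simp only:, subst prod.union_disjoint) auto
  also have "(\<Prod>p\<in>?T. 1 + 1 / real p) \<le> (\<Prod>p\<in>?T. 2)"
    by (intro prod_mono) (auto simp: divide_simps dest: prime_gt_0_nat)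
  also have "(\<Prod>p\<in>?T. 2) = (2 :: real) ^ card ?T" by simp
  also have "card ?T \<le> card {1..k}"
    using assms by (intro card_mono) (auto simp: Suc_le_eq dest: prime_gt_0_nat dvd_imp_le)
  then have "(2 :: real) ^ card ?T \<le> 2 ^ k" by (intro power_increasing) auto
  finally show ?thesis by (simp add: mult_right_mono prod_nonneg)
qed

text \<open>In \<open>L\<close>, the power of 2 pays for the prime product and the omitted primes;
  \<open>6 * m^2\<close> is \<open>3 * m\<close> from the pigeonhole times \<open>2 * m\<close> from
  \<open>sqrt n \<le> 2 * m * P\<close>. The plain bound by \<open>L\<close>, unbounded in
  \<open>y\<close>, serves to produce infinitely many \<open>n\<close>.\<close>

lemma exists_large_r3:
  fixes m y :: nat and a :: int
  assumes "m > 0" "sols3 a (int m) \<noteq> {}" "3 * m ^ 2 < y"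
  defines "L \<equiv> ln (real y + 1) / (2 ^ (2 * m + 1) * 6 * real m ^ 2)"
  obtains n where "[int n = a] (mod int m)" "L \<le> real (r3 n)" "sqrt (real n) * L \<le> real (r3 n)"
    "ln (ln (real n)) \<le> 3 * ln (real y + 1)"
proof -
  define S where "S = {p. prime p \<and> p \<le> y \<and> \<not> p dvd 2 * m}"
  define P where "P = \<Prod>S"
  define F where "F = (\<Prod>p\<in>S. 1 + 1 / real p)"
  have prS: "prime p" if "p \<in> S" for p
    using that by (auto simp: S_def)
  have finS: "finite S" unfolding S_def by auto
  have posS: "p > 0" if "p \<in> S" for p using prS[OF that] prime_gt_0_nat by blast
  have P0: "P > 0" unfolding P_def using posS by (auto intro!: prod_pos)
  have "m ^ 2 \<ge> 1" using assms(1) by (simp add: Suc_le_eq)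
  then have y0: "y > 3" using assms(3) by linarith
  have "coprime m p" if "p \<in> S" for p
    using prime_imp_coprime[OF prS[OF that], of m] that
    by (subst coprime_commute) (auto simp: S_def intro: dvd_mult)
  then have "coprime m P" unfolding P_def by (intro prod_coprime_right)
  then have "coprime (int m) (int P)" by simp
  then obtain A where A: "[A = a] (mod int m)" "[A = -1] (mod int P)"
    using binary_chinese_remainder_int by blast
  have sols_m: "sols3 A (int m) \<noteq> {}"
    using assms(2) sols3_cong[OF A(1)] by simp
  have "[A = -1] (mod int p)" if "p \<in> S" for p
    using that finS A(2) unfolding P_def by (meson cong_dvd_modulus dvd_prodI int_dvd_int_iff)
  then have card: "(\<Prod>p\<in>S. p ^ 2 + p) \<le> card (sols3 A (int (m * P)))"
    using prod_le_card_sols3[OF finS, of m A] assms(1) sols_m by (auto simp: S_def P_def)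
  moreover have "(\<Prod>p\<in>S. p ^ 2 + p) > 0" using posS by (auto intro!: prod_pos)
  ultimately have "sols3 A (int (m * P)) \<noteq> {}" by auto
  then obtain n where n: "[int n = A] (mod int (m * P))" "n \<le> 3 * (m * P) ^ 2"
      "card (sols3 A (int (m * P))) \<le> 3 * (m * P) * r3 n"
    using exists_r3_ge_card_sols3[of "m * P" A] assms(1) P0 by auto
  have "real (\<Prod>p\<in>S. p ^ 2 + p) = (\<Prod>p\<in>S. real p * real p * (1 + 1 / real p))"
    unfolding of_nat_prod using posS
    by (intro prod.cong) (auto simp: power2_eq_square field_simps)
  also have "\<dots> = real P * real P * F" by (simp add: prod.distrib P_def F_def)
  finally have "real P * (real P * F) = real (\<Prod>p\<in>S. p ^ 2 + p)" by (simp only: mult.assoc)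
  also have "\<dots> \<le> real (3 * (m * P) * r3 n)"
    unfolding of_nat_le_iff using card n(3) by (rule le_trans)
  also have "\<dots> = real P * (3 * real m * real (r3 n))" by simp
  finally have r3: "real P * F \<le> 3 * real m * real (r3 n)" using P0 by simp
  have "ln (real y + 1) \<le> 2 * (\<Prod>p | prime p \<and> p \<le> y. 1 + 1 / real p)" by (rule ln_le_prod_primes)
  also have "\<dots> \<le> 2 * (2 ^ (2 * m) * F)"
    using prod_primes_le_prod_primes_not_dvd[of "2 * m" y] assms(1) by (simp add: F_def S_def)
  finally have F: "L * (6 * real m ^ 2) \<le> F"
    unfolding L_def using assms(1) by (simp add: field_simps)
  have L0: "L \<ge> 0" unfolding L_def by simp
  have "real P * (L * (6 * real m ^ 2)) \<le> real P * F"
    using F by (rule mult_left_mono) simp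
  also note r3
  also have "real P * (L * (6 * real m ^ 2)) = (3 * real m) * ((2 * real m * real P) * L)"
    by (simp add: power2_eq_square)
  finally have key: "(2 * real m * real P) * L \<le> real (r3 n)" using assms(1) by (simp add: mult_ac)
  show ?thesis
  proof (rule that)
    show "[int n = a] (mod int m)"
      using n(1) A(1) by (auto intro: cong_trans cong_modulus_mult)
    have "1 \<le> m * P" using assms(1) P0 by (simp add: Suc_le_eq)
    then have "1 \<le> 2 * m * P" by simp
    from of_nat_mono[OF this, where 'a = real] have "1 \<le> 2 * real m * real P" by simp
    then have "1 * L \<le> (2 * real m * real P) * L"
      using L0 by (intro mult_right_mono) auto
    then show "L \<le> real (r3 n)" using key by simp
    \<comment> \<open>The factor 3 in the bound for \<open>n\<close> is rounded up to the square
      4.\<close>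
    have "real n \<le> real (2 * m * P) ^ 2"
      unfolding of_nat_power[symmetric] of_nat_le_iff using n(2) by (simp add: power_mult_distrib)
    then have "sqrt (real n) \<le> real (2 * m * P)" by (intro real_le_lsqrt) auto
    then have "sqrt (real n) \<le> 2 * real m * real P" by simp
    then show "sqrt (real n) * L \<le> real (r3 n)"
      using key L0 by (meson mult_right_mono order_trans)
    show "ln (ln (real n)) \<le> 3 * ln (real y + 1)"
    proof (cases "n > 1")
      case False
      \<comment> \<open>By the convention \<open>ln 0 = 0\<close>, the iterated logarithm is 0 in
        both cases.\<close>
      then have "n = 0 \<or> n = 1" by auto
      then show ?thesis by auto
    next
      case True
      \<comment> \<open>The crude bound \<open>P \<le> y ^ y\<close> suffices: with
        \<open>3 * m^2 < y\<close> it gives \<open>n \<le> y ^ (2 * y + 1)\<close>, so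
        \<open>ln n \<le> y ^ 3\<close>, whence the factor 3 after another logarithm.\<close>
      have "P \<le> (\<Prod>p\<in>S. y)" unfolding P_def by (intro prod_mono) (auto simp: S_def)
      also have "\<dots> = y ^ card S" by simp
      also have "card S \<le> card {1..y}"
        by (intro card_mono) (auto simp: S_def Suc_le_eq dest: prime_gt_0_nat)
      then have "y ^ card S \<le> y ^ y" using y0 by (intro power_increasing) auto
      finally have "P ^ 2 \<le> (y ^ y) ^ 2" by (intro power_mono) auto
      then have "3 * m ^ 2 * P ^ 2 \<le> y * (y ^ y) ^ 2"
        using assms(3) by (intro mult_mono) auto
      then have "n \<le> y * (y ^ y) ^ 2" using n(2) by (simp add: power_mult_distrib)
      also have "y * (y ^ y) ^ 2 = y ^ (2 * y + 1)" by (simp add: mult.commute flip: power_mult)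
      finally have "real n \<le> real y ^ (2 * y + 1)" unfolding of_nat_power[symmetric] of_nat_le_iff .
      then have "ln (real n) \<le> ln (real y ^ (2 * y + 1))" using True by (subst ln_le_cancel_iff) auto
      also have "\<dots> = (2 * y + 1) * ln (real y)" using y0 by (subst ln_realpow) auto
      also have "\<dots> \<le> (real y * real y) * real y"
      proof (intro mult_mono)
        have "2 * y + 1 \<le> 3 * y" using y0 by simp
        also have "\<dots> \<le> y * y" using y0 by (intro mult_right_mono) auto
        finally have "2 * y + 1 \<le> y * y" .
        then show "real (2 * y + 1) \<le> real y * real y"
          unfolding of_nat_mult[symmetric] of_nat_le_iff .
        show "ln (real y) \<le> real y" using y0 ln_le_minus_one[of "real y"] by simp
      qed (use y0 in auto)
      also have "\<dots> = real y ^ 3" by (simp add: power3_eq_cube)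
      finally have "ln (ln (real n)) \<le> ln (real y ^ 3)" using True y0 by (subst ln_le_cancel_iff) auto
      also have "\<dots> = 3 * ln (real y)" using y0 by (simp add: ln_realpow)
      also have "\<dots> \<le> 3 * ln (real y + 1)" using y0 by simp
      finally show ?thesis .
    qed
  qed
qed

theorem theorem1p1:
  fixes m :: nat
  assumes "m > 0"
  shows "\<exists>c > (0::real). \<forall>a :: int.
           (\<exists>z1 z2 z3 :: int. [z1^2 + z2^2 + z3^2 = a] (mod int m)) \<longrightarrow>
           infinite {n :: nat. n > 0 \<and> [int n = a] (mod int m) \<and>
                      real (r3 n) \<ge> c * sqrt (real n) * ln (ln (real n))}"
proof -
  \<comment> \<open>\<open>K\<close> is the denominator of \<open>L\<close>; the 3 in
    \<open>1 / (3 * K)\<close> absorbs the one in \<open>ln (ln n) \<le> 3 * ln (y + 1)\<close>.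
    Neither involves \<open>a\<close>.\<close>
  define K where "K = 2 ^ (2 * m + 1) * 6 * real m ^ 2"
  have K: "K > 0" using assms by (simp add: K_def)
  have "infinite {n :: nat. n > 0 \<and> [int n = a] (mod int m) \<and>
      real (r3 n) \<ge> 1 / (3 * K) * sqrt (real n) * ln (ln (real n))}" (is "infinite ?N")
    if z: "[z1^2 + z2^2 + z3^2 = a] (mod int m)" for a z1 z2 z3 :: int
  proof
    assume fin: "finite ?N"
    \<comment> \<open>A finite set would bound \<open>r3\<close> by \<open>B\<close>, while
      \<open>y\<close> is chosen so that \<open>L\<close> exceeds \<open>B\<close>. Inserting 0
      makes the maximum well defined and forces the new \<open>n\<close> to be positive.\<close>
    define B where "B = Max (r3 ` insert 0 ?N)"
    obtain y :: nat where "max (exp (K * B)) (3 * m ^ 2) < y"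
      using reals_Archimedean2 by blast
    then have y: "exp (K * B) < real y + 1" "3 * m ^ 2 < y"
      by (simp_all flip: of_nat_power of_nat_mult)
    then have "K * B < ln (real y + 1)"
      by (subst ln_exp[symmetric], subst ln_less_cancel_iff) auto
    then have lnB: "ln (real y + 1) / K > B" using K by (simp add: field_simps)
    have "sols3 a (int m) \<noteq> {}" using mod_in_sols3[OF _ z] assms by force
    then obtain n where n: "[int n = a] (mod int m)" "ln (real y + 1) / K \<le> real (r3 n)"
        "sqrt (real n) * (ln (real y + 1) / K) \<le> real (r3 n)" "ln (ln (real n)) \<le> 3 * ln (real y + 1)"
      using exists_large_r3[OF assms _ y(2)] unfolding K_def by blast
    have "r3 n > B" using lnB n(2) by linarith
    moreover have "r3 k \<le> B" if "k \<in> insert 0 ?N" for k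
      unfolding B_def using fin that by (intro Max_ge) auto
    ultimately have "n \<notin> insert 0 ?N" by fastforce
    moreover have "1 / (3 * K) * sqrt (real n) * ln (ln (real n)) \<le> real (r3 n)"
    proof -
      have "1 / (3 * K) * sqrt (real n) * ln (ln (real n))
          \<le> 1 / (3 * K) * sqrt (real n) * (3 * ln (real y + 1))"
        using n(4) K by (intro mult_left_mono) auto
      also have "\<dots> = sqrt (real n) * (ln (real y + 1) / K)" using K by (simp add: field_simps)
      finally show ?thesis using n(3) by linarith
    qed
    ultimately show False using n(1) by auto
  qed
  then show ?thesis using K by (intro exI[of _ "1 / (3 * K)"]) auto
qed

end
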